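(* The functions $R$ and $T$ differ by the multiplicative coboundary of the function $\beta\colon\mathbb{R}_{>0}\to(0,\infty)$, $\beta(x)=x$: for all real $x>0$ and $r\ge 0$, $$\frac{R(x,r)}{T(x,r)}=\frac{x+2r}{x}=\frac{\beta(x+2r)}{\beta(x)}.$$ Equivalently, $T(x,r)=\dfrac{\beta(x)}{\beta(x+2r)}\,R(x,r)$.
   Context: For real $x>0$ let $\mathcal{M}(x)$ be the positive Radon measure on $(0,\infty)$ given by $$d\mathcal{M}(x)(u)=\frac{\pi^{x/2}}{\Gamma(x/2)}\,u^{x/2-1}\,du.$$ For $x>0$, $r\ge 0$, the radial-integration cocycle is $$R(x,r)=\pi^r\,\frac{\Gamma(x/2)}{\Gamma(x/2+r)},$$ the coefficient for which $u\mapsto R(x,r)\,u^r$ is the Radon--Nikodym density of $\mathcal{M}(x+2r)$ with respect to $\mathcal{M}(x)$. Let $V(x):=\mathcal{M}(x)\bigl((0,1)\bigr)$ be the measure of the unit interval. The ball-volume cocycle is $$T(x,r):=\frac{V(x+2r)}{V(x)},\qquad x>0,\ r\ge 0.$$ *)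

theory Defs
  imports "HOL-Analysis.Analysis"
begin

definition radial_measure :: "real \<Rightarrow> real measure" where
  "radial_measure x =
     density (restrict_space lborel {0<..})
       (\<lambda>u. ennreal (pi powr (x / 2) / Gamma (x / 2) * u powr (x / 2 - 1)))"

definition radial_cocycle :: "real \<Rightarrow> real \<Rightarrow> real" where
  "radial_cocycle x r = pi powr r * (Gamma (x / 2) / Gamma (x / 2 + r))"

definition unit_interval_volume :: "real \<Rightarrow> real" where
  "unit_interval_volume x = measure (radial_measure x) {0<..<1}"

definition ball_volume_cocycle :: "real \<Rightarrow> real \<Rightarrow> real" where
  "ball_volume_cocycle x r = unit_interval_volume (x + 2 * r) / unit_interval_volume x"

(* Only the values of beta_fun on the positive reals matter. *)
definition beta_fun :: "real \<Rightarrow> real" where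
  "beta_fun x = x"

lemma radial_measure_shift:
  assumes x: "x > 0" and r: "r \<ge> 0"
  shows "radial_measure (x + 2 * r) =
           density (radial_measure x) (\<lambda>u. ennreal (radial_cocycle x r * u powr r))"
proof -
  let ?M = "restrict_space lborel {0<..} :: real measure"
  let ?d = "\<lambda>y u. pi powr (y / 2) / Gamma (y / 2) * u powr (y / 2 - 1) :: real"
  let ?c = "\<lambda>u. radial_cocycle x r * u powr r"
  have d: "(\<lambda>u. ennreal (?d y u)) \<in> borel_measurable ?M" for y
    by (rule measurable_restrict_space1) simp
  have c: "(\<lambda>u. ennreal (?c u)) \<in> borel_measurable ?M"
    by (rule measurable_restrict_space1) simp
  have G: "Gamma (x / 2) > 0" "Gamma (x / 2 + r) > 0"
    using x r by auto
  have e: "ennreal (?d (x + 2 * r) u) = ennreal (?d x u) * ennreal (?c u)"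
    if "u \<in> space ?M" for u
  proof -
    have h: "(x + 2 * r) / 2 = x / 2 + r" by (simp add: field_simps)
    have p: "u powr (x / 2 + r - 1) = u powr (x / 2 - 1) * u powr r"
      by (simp add: powr_add [symmetric] algebra_simps)
    have q: "pi powr (x / 2 + r) = pi powr (x / 2) * pi powr r"
      by (rule powr_add)
    have a: "P * Q / b * (U * W) = P / a * U * (Q * (a / b) * W)"
      if "a > 0" for P Q U W a b :: real
      using that by (simp add: field_simps)
    have "?d (x + 2 * r) u = ?d x u * ?c u"
      unfolding h p q radial_cocycle_def by (rule a [OF G(1)])
    moreover have "0 \<le> ?d x u"
      using G by (auto intro!: mult_nonneg_nonneg)
    ultimately show ?thesis by (simp only: ennreal_mult')
  qed
  have "density (radial_measure x) (\<lambda>u. ennreal (?c u)) =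
          density ?M (\<lambda>u. ennreal (?d x u) * ennreal (?c u))"
    unfolding radial_measure_def by (rule density_density_eq [OF d c])
  also have "\<dots> = density ?M (\<lambda>u. ennreal (?d (x + 2 * r) u))"
    by (intro density_cong borel_measurable_times_ennreal d c AE_I2 e [symmetric])
  finally show ?thesis by (simp add: radial_measure_def)
qed

end

theory Submission
  imports Defs
begin

text \<open>The factor comes from one antiderivative: integrating u^(x/2-1) over (0,1) gives 2/x,
  which \<Gamma>(s+1) = s \<Gamma>(s) absorbs into V(x) = \<pi>^(x/2) / \<Gamma>(x/2+1)
  (\<open>unit_interval_volume_eq\<close>). The quotient T thus resembles R with both Gamma
  arguments raised by one; lowering them again by the same recurrence leaves (x/2) / (x/2+r), that
  is \<beta>(x) / \<beta>(x+2r).\<close>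

lemma Gamma_real_plus1: "Gamma (y + 1) = y * Gamma y" if "y > 0" for y :: real
  using that by (intro Gamma_plus1) auto

text \<open>Computing \<open>emeasure\<close> as a real value also shows finiteness, so
  \<open>measure\<close> takes the same value.\<close>

lemma emeasure_radial_measure_unit_interval:
  assumes x: "x > 0"
  shows "emeasure (radial_measure x) {0<..<1} = ennreal (pi powr (x / 2) / Gamma (x / 2 + 1))"
proof -
  define c where "c = pi powr (x / 2) / Gamma (x / 2)"
  have c: "c \<ge> 0"
    using x by (simp add: c_def)
  \<comment> \<open>For x < 2 the integrand is unbounded near 0; x > 0 puts the exponent above -1,
    which makes it integrable.\<close>
  have "((\<lambda>u. u powr (x / 2 - 1)) has_integral 2 / x) {0..1}"
    using has_integral_powr_from_0[of "x / 2 - 1" 1] x by simp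
  then have "((\<lambda>u. u powr (x / 2 - 1)) has_integral 2 / x) {0<..<1}"
    by (simp only: has_integral_Icc_iff_Ioo)
  then have "((\<lambda>u. c * u powr (x / 2 - 1)) has_integral c * (2 / x)) {0<..<1}"
    by (rule has_integral_mult_right)
  \<comment> \<open>Nonnegativity of \<open>c\<close> allows the gauge integral to be read as a
    Lebesgue integral.\<close>
  from nn_integral_has_integral_lebesgue[OF _ this] c
  have *: "(\<integral>\<^sup>+u. ennreal (indicator {0<..<1} u * (c * u powr (x / 2 - 1))) \<partial>lborel)
             = ennreal (c * (2 / x))"
    by simp
  have "(\<lambda>u. ennreal (c * u powr (x / 2 - 1))) \<in> borel_measurable (restrict_space lborel {0<..})"
    by (rule measurable_restrict_space1) simp
  moreover have "{0<..<1 :: real} \<in> sets (restrict_space lborel {0<..})"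
    by (subst sets_restrict_space_iff) auto
  ultimately have "emeasure (radial_measure x) {0<..<1} =
          (\<integral>\<^sup>+u\<in>{0<..<1}. ennreal (c * u powr (x / 2 - 1)) \<partial>restrict_space lborel {0<..})"
    unfolding radial_measure_def c_def by (rule emeasure_density)
  also have "\<dots> = (\<integral>\<^sup>+u. ennreal (indicator {0<..<1} u * (c * u powr (x / 2 - 1))) \<partial>lborel)"
    \<comment> \<open>The interval lies inside the positive reals, so restricting
      \<open>lborel\<close> to them changes nothing.\<close>
    by (subst nn_integral_restrict_space) (auto intro!: nn_integral_cong simp: indicator_def)
  also have "\<dots> = ennreal (c * (2 / x))"
    by (rule *)
  also have "c * (2 / x) = pi powr (x / 2) / Gamma (x / 2 + 1)"
    using x by (simp add: c_def Gamma_real_plus1)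
  finally show ?thesis .
qed

lemma unit_interval_volume_eq:
  assumes "x > 0"
  shows "unit_interval_volume x = pi powr (x / 2) / Gamma (x / 2 + 1)"
  using assms
  by (simp add: unit_interval_volume_def measure_def emeasure_radial_measure_unit_interval)

theorem theorem6p1:
  fixes x r :: real
  assumes "x > 0" and "r \<ge> 0"
  shows "radial_cocycle x r / ball_volume_cocycle x r = (x + 2 * r) / x
       \<and> (x + 2 * r) / x = beta_fun (x + 2 * r) / beta_fun x
       \<and> ball_volume_cocycle x r = beta_fun x / beta_fun (x + 2 * r) * radial_cocycle x r"
proof -
  have pos: "x + 2 * r > 0" "Gamma (x / 2) > 0" "Gamma (x / 2 + r) > 0"
    using assms by auto
  have half: "(x + 2 * r) / 2 = x / 2 + r"
    by simp
  \<comment> \<open>Used with \<open>a\<close>, \<open>b\<close> the recurrence factors x/2, x/2+r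
    and \<open>g\<close>, \<open>h\<close> their Gamma values. If one of these four is 0, both sides
    are 0.\<close>
  have cancel: "p * q / (b * h) / (p / (a * g)) = a / b * (q * (g / h))"
    if "p > 0" for p q a b g h :: real
    using that by simp
  have "ball_volume_cocycle x r = pi powr (x / 2) * pi powr r / ((x / 2 + r) * Gamma (x / 2 + r))
          / (pi powr (x / 2) / (x / 2 * Gamma (x / 2)))"
    using assms pos(1)
    by (simp only: ball_volume_cocycle_def unit_interval_volume_eq half powr_add Gamma_real_plus1
        half_gt_zero add_pos_nonneg)
  also have "\<dots> = x / 2 / (x / 2 + r) * radial_cocycle x r"
    unfolding radial_cocycle_def by (rule cancel) simp
  also have "x / 2 / (x / 2 + r) = x / (x + 2 * r)"
    unfolding half[symmetric] by simp
  finally have T: "ball_volume_cocycle x r = x / (x + 2 * r) * radial_cocycle x r" .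
  \<comment> \<open>R must be nonzero to cancel in R / T.\<close>
  have "radial_cocycle x r > 0"
    using pos by (simp add: radial_cocycle_def)
  with T show ?thesis
    using assms(1) pos(1) by (simp add: beta_fun_def)
qed

end
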